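(* Let $G$ be a simple connected graph with $n\geq 3$ vertices and $m$ edges. Let $n_i$ denote the number of vertices of $G$ with edge neighborhood degree $i$, and let $\delta$ and $\Delta$ denote the minimum and maximum edge neighborhood degrees of $G$, respectively, where $\delta\neq\Delta$. Let $M_1=M_1(G)$, let $a\in\mathbb{R}\setminus\{0,1\}$ and set $s_a=\frac{\Delta^a-\delta^a}{\Delta-\delta}$. Then the following statements hold. (1) \[KB^a(G)=n\delta^a+(2M_1-4m-n\delta)s_a+\sum_{i=1}^{\Delta-\delta-1}n_{\delta+i}\left[(\delta+i)^a-\delta^a-i s_a\right].\] If $a<0$ or $a>1$, the coefficients $(\delta+i)^a-\delta^a-i s_a$ are nonpositive for $1\leq i\leq\Delta-\delta-1$; if $0<a<1$, they are nonnegative. (2) If $a>1$, then \[\ln\left[\prod_{v\in V(G)}S_e(v)^a\right]=a\left[n\ln\delta+\frac{(2M_1-4m-n\delta)(\ln\Delta-\ln\delta)}{\Delta-\delta}+\sum_{i=1}^{\Delta-\delta-1}n_{\delta+i}\left(\ln(\delta+i)-\ln\delta-i\,\frac{\ln\Delta-\ln\delta}{\Delta-\delta}\right)\right].\] Moreover, the coefficients $\ln(\delta+i)-\ln\delta-i\,\frac{\ln\Delta-\ln\delta}{\Delta-\delta}$ of $n_{\delta+i}$ are nonnegative for $1\leq i\leq\Delta-\delta-1$.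
   Context: Graphs are finite. For a simple graph $G$ with vertex set $V(G)$ and edge set $E(G)$, $d(u)$ denotes the degree of a vertex $u$. The degree of an edge $e=uv$ is $d_G(e)=d(u)+d(v)-2$. The edge neighborhood degree $S_e(v)$ of a vertex $v$ is the sum of the degrees $d_G(e)$ of all edges $e$ incident to $v$. The first Zagreb index is $M_1(G)=\sum_{u\in V(G)}d(u)^2$. For real $a\neq 0,1$, the general Kulli-Basava index is $KB^a(G)=\sum_{v\in V(G)}S_e(v)^a$, and the general multiplicative Kulli-Basava index is $\prod_{v\in V(G)}S_e(v)^a$. *)

theory Defs
  imports Complex_Main "Graph_Theory.Digraph_Component"
begin

text \<open>
  Graph_Theory represents a finite simple undirected graph as a finite symmetric digraph without
  loops and parallel arcs (locale \<open>graph\<close>), so an undirected edge \<open>uv\<close> is a pair of opposite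
  arcs. Edges are counted, and summed over, as the unordered sets \<open>{u, v}\<close>.
\<close>

definition uedges :: "('a, 'b) pre_digraph \<Rightarrow> 'a set set" where
  "uedges G = {{u, v} | u v. u \<rightarrow>\<^bsub>G\<^esub> v}"

definition incident_uedges :: "('a, 'b) pre_digraph \<Rightarrow> 'a \<Rightarrow> 'a set set" where
  "incident_uedges G v = {e \<in> uedges G. v \<in> e}"

definition vdegree :: "('a, 'b) pre_digraph \<Rightarrow> 'a \<Rightarrow> nat" where
  "vdegree G v = card (incident_uedges G v)"

text \<open>
  The subtraction on \<open>nat\<close> below does not truncate on the edges of a graph: both endpoints of an
  edge have degree at least 1.
\<close>

definition edge_degree :: "('a, 'b) pre_digraph \<Rightarrow> 'a set \<Rightarrow> nat" where
  "edge_degree G e = (\<Sum>u\<in>e. vdegree G u) - 2"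

definition edge_nbhd_degree :: "('a, 'b) pre_digraph \<Rightarrow> 'a \<Rightarrow> nat" where
  "edge_nbhd_degree G v = (\<Sum>e\<in>incident_uedges G v. edge_degree G e)"

definition num_edge_nbhd_degree :: "('a, 'b) pre_digraph \<Rightarrow> nat \<Rightarrow> nat" where
  "num_edge_nbhd_degree G i = card {v \<in> verts G. edge_nbhd_degree G v = i}"

definition min_edge_nbhd_degree :: "('a, 'b) pre_digraph \<Rightarrow> nat" where
  "min_edge_nbhd_degree G = Min (edge_nbhd_degree G ` verts G)"

definition max_edge_nbhd_degree :: "('a, 'b) pre_digraph \<Rightarrow> nat" where
  "max_edge_nbhd_degree G = Max (edge_nbhd_degree G ` verts G)"

definition first_zagreb :: "('a, 'b) pre_digraph \<Rightarrow> nat" where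
  "first_zagreb G = (\<Sum>u\<in>verts G. (vdegree G u)\<^sup>2)"

text \<open>
  In a connected graph with at least 3 vertices every edge neighborhood degree is positive, so
  the convention \<open>0 powr a = 0\<close> plays no role there.
\<close>

definition kulli_basava :: "real \<Rightarrow> ('a, 'b) pre_digraph \<Rightarrow> real" where
  "kulli_basava a G = (\<Sum>v\<in>verts G. real (edge_nbhd_degree G v) powr a)"

definition mult_kulli_basava :: "real \<Rightarrow> ('a, 'b) pre_digraph \<Rightarrow> real" where
  "mult_kulli_basava a G = (\<Prod>v\<in>verts G. real (edge_nbhd_degree G v) powr a)"

lemma (in graph) vdegree_eq_out_degree: "vdegree G v = out_degree G v"
proof -
  have "bij_betw (\<lambda>e. {tail G e, head G e}) (out_arcs G v) (incident_uedges G v)"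
    unfolding bij_betw_def
  proof
    show "inj_on (\<lambda>e. {tail G e, head G e}) (out_arcs G v)"
      by (rule inj_onI)
        (auto simp: out_arcs_def doubleton_eq_iff arc_to_ends_def intro!: no_multi_arcs)
    show "(\<lambda>e. {tail G e, head G e}) ` out_arcs G v = incident_uedges G v"
    proof (intro set_eqI iffI)
      fix x assume "x \<in> (\<lambda>e. {tail G e, head G e}) ` out_arcs G v"
      then show "x \<in> incident_uedges G v"
        by (auto simp: out_arcs_def incident_uedges_def uedges_def arcs_ends_conv)
    next
      fix x assume "x \<in> incident_uedges G v"
      then obtain u w where x: "x = {u, w}" "u \<rightarrow>\<^bsub>G\<^esub> w" "v \<in> {u, w}"
        by (auto simp: incident_uedges_def uedges_def)
      then obtain w' where "x = {v, w'}" "v \<rightarrow>\<^bsub>G\<^esub> w'"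
        using arcs_ends_symmetric[OF sym_arcs] by (auto simp: insert_commute)
      then show "x \<in> (\<lambda>e. {tail G e, head G e}) ` out_arcs G v"
        by (auto simp: out_arcs_def arcs_ends_conv)
    qed
  qed
  then show ?thesis
    by (simp add: vdegree_def out_degree_def bij_betw_same_card)
qed

lemma (in graph) edge_degree_conv:
  assumes "u \<rightarrow>\<^bsub>G\<^esub> v"
  shows "edge_degree G {u, v} = vdegree G u + vdegree G v - 2"
proof -
  have "u \<noteq> v" using assms adj_not_same by auto
  then show ?thesis by (simp add: edge_degree_def)
qed

end

theory Submission
  imports Defs "HOL-Analysis.Convex"
begin

text \<open>
  Both identities are one statement about a function \<open>f\<close> of the edge neighborhood degree, taken
  for \<open>f x = x powr a\<close> and for \<open>f x = ln x\<close>; the latter applies because the logarithm turns the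
  product into \<open>a\<close> times the sum of \<open>ln (S_e(v))\<close>. Replace \<open>f\<close> by its chord over the range
  \<open>[\<delta>, \<Delta>]\<close> of the edge neighborhood degrees. The sum of the chord values depends only on the
  number of vertices and on \<open>\<Sum>v. S_e(v)\<close>, which double counting evaluates as
  \<open>2 * M\<^sub>1 - 4 * m\<close> (\<open>sum_edge_nbhd_degree\<close>). The difference between \<open>f\<close> and the chord
  vanishes at \<open>\<delta>\<close> and \<open>\<Delta>\<close>, so grouping the vertices by edge neighborhood degree
  leaves exactly the contributions of the values strictly between (\<open>sum_eq_chord_plus_remainder\<close>).

  The coefficients are thus the differences between a function and its chord. Their signs express
  that a convex function lies below its chords and a concave one above: \<open>x powr a\<close> is convex on
  the positive reals for \<open>a < 0\<close> or \<open>a > 1\<close> and concave for \<open>0 < a < 1\<close>, and \<open>ln\<close> is concave.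
  For this, and for taking the logarithm of the product factor by factor, all edge neighborhood
  degrees have to be positive. That is where connectedness and \<open>n \<ge> 3\<close> enter: without them, a
  vertex could be isolated or lie on an isolated edge, and only then would
  its edge neighborhood degree be \<open>0\<close> (\<open>edge_nbhd_degree_pos\<close>).
\<close>


section \<open>Sums over incident vertices and edges\<close>

context graph
begin

lemma finite_uedges: "finite (uedges G)"
proof -
  have "uedges G = (\<lambda>e. {tail G e, head G e}) ` arcs G"
    by (auto simp: uedges_def arcs_ends_conv)
  then show ?thesis by simp
qed

lemma finite_incident_uedges: "finite (incident_uedges G v)"
  unfolding incident_uedges_def using finite_uedges by simp

lemma uedge_subset_verts:
  assumes "e \<in> uedges G"
  shows "e \<subseteq> verts G"
  using assms adj_in_verts by (auto simp: uedges_def)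

lemma card_uedge:
  assumes "e \<in> uedges G"
  shows "card e = 2"
proof -
  obtain u v where "e = {u, v}" and "u \<rightarrow>\<^bsub>G\<^esub> v"
    using assms by (auto simp: uedges_def)
  then have "u \<noteq> v" using adj_not_same by auto
  with \<open>e = {u, v}\<close> show ?thesis by simp
qed

lemma vdegree_pos:
  assumes "u \<rightarrow>\<^bsub>G\<^esub> v"
  shows "vdegree G u > 0"
proof -
  have "{u, v} \<in> incident_uedges G u"
    using assms by (auto simp: incident_uedges_def uedges_def)
  then show ?thesis
    using finite_incident_uedges by (auto simp: vdegree_def card_gt_0_iff)
qed

lemma sum_incident_uedges_swap:
  fixes g :: "'a \<Rightarrow> 'a set \<Rightarrow> real"
  shows "(\<Sum>v\<in>verts G. \<Sum>e\<in>incident_uedges G v. g v e) = (\<Sum>e\<in>uedges G. \<Sum>v\<in>e. g v e)"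
proof -
  have "(\<Sum>v\<in>verts G. \<Sum>e\<in>incident_uedges G v. g v e)
      = (\<Sum>e\<in>uedges G. \<Sum>v\<in>{v \<in> verts G. v \<in> e}. g v e)"
    unfolding incident_uedges_def by (intro sum.swap_restrict finite_verts finite_uedges)
  also have "\<dots> = (\<Sum>e\<in>uedges G. \<Sum>v\<in>e. g v e)"
  proof (rule sum.cong[OF refl])
    fix e assume "e \<in> uedges G"
    then have "{v \<in> verts G. v \<in> e} = e" using uedge_subset_verts by auto
    then show "(\<Sum>v\<in>{v \<in> verts G. v \<in> e}. g v e) = (\<Sum>v\<in>e. g v e)" by simp
  qed
  finally show ?thesis .
qed

lemma real_edge_degree:
  assumes "e \<in> uedges G"
  shows "real (edge_degree G e) = (\<Sum>u\<in>e. real (vdegree G u)) - 2"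
proof -
  obtain u v where e: "e = {u, v}" and uv: "u \<rightarrow>\<^bsub>G\<^esub> v"
    using assms by (auto simp: uedges_def)
  have vu: "v \<rightarrow>\<^bsub>G\<^esub> u" using arcs_ends_symmetric[OF sym_arcs uv] .
  have "u \<noteq> v" using uv adj_not_same by auto
  then show ?thesis
    using vdegree_pos[OF uv] vdegree_pos[OF vu] edge_degree_conv[OF uv]
    by (simp add: e of_nat_diff)
qed

text \<open>
  Double counting, twice. Every edge is counted at both of its endpoints, so the sum equals
  \<open>2 * (\<Sum>e. d(e))\<close>; and in \<open>\<Sum>uv. d(u) + d(v)\<close> each vertex contributes its degree once per
  incident edge, that is, the square of its degree.
\<close>

lemma sum_edge_nbhd_degree:
  "(\<Sum>v\<in>verts G. real (edge_nbhd_degree G v))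
     = 2 * real (first_zagreb G) - 4 * real (card (uedges G))"
proof -
  have "(\<Sum>v\<in>verts G. real (edge_nbhd_degree G v))
      = (\<Sum>e\<in>uedges G. \<Sum>v\<in>e. real (edge_degree G e))"
    unfolding edge_nbhd_degree_def of_nat_sum by (rule sum_incident_uedges_swap)
  also have "\<dots> = (\<Sum>e\<in>uedges G. 2 * (\<Sum>u\<in>e. real (vdegree G u)) - 4)"
    by (rule sum.cong[OF refl]) (simp add: card_uedge real_edge_degree)
  also have "\<dots> = 2 * (\<Sum>e\<in>uedges G. \<Sum>u\<in>e. real (vdegree G u)) - 4 * real (card (uedges G))"
    by (simp add: sum_subtractf sum_distrib_left)
  also have "(\<Sum>e\<in>uedges G. \<Sum>u\<in>e. real (vdegree G u)) = real (first_zagreb G)"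
    unfolding sum_incident_uedges_swap[symmetric]
    by (simp add: first_zagreb_def vdegree_def power2_eq_square)
  finally show ?thesis .
qed


section \<open>Positivity of edge neighborhood degrees\<close>

text \<open>
  The form in which connectedness is used: a vertex without neighbors, or an isolated pair of
  adjacent vertices, would be a closed set and hence the whole graph.
\<close>

lemma adjacency_closed_eq_verts:
  assumes con: "Digraph_Component.connected G"
    and "S \<subseteq> verts G" and "S \<noteq> {}"
    and closed: "\<And>x y. x \<in> S \<Longrightarrow> x \<rightarrow>\<^bsub>G\<^esub> y \<Longrightarrow> y \<in> S"
  shows "S = verts G"
proof
  show "verts G \<subseteq> S"
  proof
    fix w assume w: "w \<in> verts G"
    obtain v where v: "v \<in> S" "v \<in> verts G" using assms by blast
    have "strongly_connected G"
      using symmetric_connected_imp_strongly_connected[OF sym_arcs con] .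
    then have "v \<rightarrow>\<^sup>*\<^bsub>G\<^esub> w" using v w by auto
    then show "w \<in> S"
      by (induction rule: reachable_induct) (use v closed in auto)
  qed
qed fact

lemma neighbor_unique_if_vdegree_1:
  assumes "vdegree G u = 1" and "u \<rightarrow>\<^bsub>G\<^esub> v" and "u \<rightarrow>\<^bsub>G\<^esub> w"
  shows "w = v"
proof -
  have "{u, v} \<in> incident_uedges G u" "{u, w} \<in> incident_uedges G u"
    using assms by (auto simp: incident_uedges_def uedges_def)
  then have "{u, v} = {u, w}"
    using assms(1) unfolding vdegree_def by (metis card_1_singletonE singletonD)
  then show ?thesis by (auto simp: doubleton_eq_iff)
qed

text \<open>
  An edge of degree \<open>0\<close> joins two vertices of degree \<open>1\<close>, and these form a component of their
  own. With a third vertex present this contradicts connectedness, so the edge that every vertex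
  then has contributes a positive amount.
\<close>

lemma edge_nbhd_degree_pos:
  assumes con: "Digraph_Component.connected G"
    and n: "card (verts G) \<ge> 3"
    and v: "v \<in> verts G"
  shows "edge_nbhd_degree G v > 0"
proof -
  have "{v} \<noteq> verts G"
  proof
    assume "{v} = verts G"
    from arg_cong[OF this, of card] n show False by simp
  qed
  then obtain u where vu: "v \<rightarrow>\<^bsub>G\<^esub> u"
    using adjacency_closed_eq_verts[OF con, of "{v}"] v by auto
  have uv: "u \<rightarrow>\<^bsub>G\<^esub> v" using arcs_ends_symmetric[OF sym_arcs vu] .
  have "edge_degree G {v, u} > 0"
  proof (rule ccontr)
    assume "\<not> edge_degree G {v, u} > 0"
    then have deg: "vdegree G v = 1" "vdegree G u = 1"
      using edge_degree_conv[OF vu] vdegree_pos[OF vu] vdegree_pos[OF uv] by auto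
    have "{v, u} = verts G"
    proof (rule adjacency_closed_eq_verts[OF con])
      show "{v, u} \<subseteq> verts G" using adj_in_verts[OF vu] by simp
      show "y \<in> {v, u}" if "x \<in> {v, u}" "x \<rightarrow>\<^bsub>G\<^esub> y" for x y
        using that neighbor_unique_if_vdegree_1[OF deg(1) vu]
          neighbor_unique_if_vdegree_1[OF deg(2) uv] by auto
    qed simp
    moreover have "card {v, u} \<le> 2" by (simp add: card_insert_if)
    ultimately show False using n by simp
  qed
  moreover have "{v, u} \<in> incident_uedges G v"
    using vu by (auto simp: incident_uedges_def uedges_def)
  ultimately show ?thesis
    unfolding edge_nbhd_degree_def using finite_incident_uedges by (auto simp: sum_pos2)
qed

end


section \<open>Interpolating a sum by the chord of a function\<close>

text \<open>
  Subtracting from \<open>f\<close> its chord over \<open>[d, D]\<close> leaves a function that vanishes at both ends, so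
  only the strictly intermediate values of \<open>F\<close> survive in the sum of the remainders, and grouping
  by these values gives the counts. The chord, being affine, sees \<open>F\<close> only through \<open>\<Sum>v\<in>V. F v\<close>.
\<close>

lemma sum_eq_chord_plus_remainder:
  fixes f :: "nat \<Rightarrow> real" and F :: "'v \<Rightarrow> nat" and d D :: nat and s :: real
  assumes fin: "finite V"
    and range: "\<And>v. v \<in> V \<Longrightarrow> d \<le> F v \<and> F v \<le> D"
    and "d < D"
    and s: "s = (f D - f d) / (real D - real d)"
  shows "(\<Sum>v\<in>V. f (F v)) =
      real (card V) * f d + ((\<Sum>v\<in>V. real (F v)) - real (card V) * real d) * s
      + (\<Sum>i = 1..D - d - 1. real (card {v \<in> V. F v = d + i}) * (f (d + i) - f d - real i * s))"
proof -
  define r where "r i = f (d + i) - f d - real i * s" for i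
  have r0: "r 0 = 0" by (simp add: r_def)
  have rD: "r (D - d) = 0"
    using \<open>d < D\<close> by (simp add: r_def s of_nat_diff)
  have "(\<Sum>v\<in>V. r (F v - d)) = (\<Sum>i = 0..D - d. \<Sum>v | v \<in> V \<and> F v - d = i. r (F v - d))"
    by (rule sum.group[symmetric]) (use fin range in \<open>auto simp: diff_le_mono\<close>)
  also have "\<dots> = (\<Sum>i = 0..D - d. real (card {v \<in> V. F v = d + i}) * r i)"
  proof (rule sum.cong[OF refl])
    fix i
    have "{v \<in> V. F v - d = i} = {v \<in> V. F v = d + i}" using range by fastforce
    then show "(\<Sum>v | v \<in> V \<and> F v - d = i. r (F v - d)) = real (card {v \<in> V. F v = d + i}) * r i"
      by simp
  qed
  also have "\<dots> = (\<Sum>i = 1..D - d - 1. real (card {v \<in> V. F v = d + i}) * r i)"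
  proof (rule sum.mono_neutral_right)
    show "\<forall>i\<in>{0..D - d} - {1..D - d - 1}. real (card {v \<in> V. F v = d + i}) * r i = 0"
    proof
      fix i assume "i \<in> {0..D - d} - {1..D - d - 1}"
      then have "i = 0 \<or> i = D - d" by auto
      then show "real (card {v \<in> V. F v = d + i}) * r i = 0" using r0 rD by auto
    qed
  qed auto
  finally have r_sum: "(\<Sum>v\<in>V. r (F v - d))
      = (\<Sum>i = 1..D - d - 1. real (card {v \<in> V. F v = d + i}) * r i)" .
  have "(\<Sum>v\<in>V. f (F v)) = (\<Sum>v\<in>V. f d + (real (F v) - real d) * s + r (F v - d))"
    by (rule sum.cong[OF refl]) (use range in \<open>simp add: r_def of_nat_diff\<close>)
  also have "\<dots> = real (card V) * f d + ((\<Sum>v\<in>V. real (F v)) - real (card V) * real d) * s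
      + (\<Sum>v\<in>V. r (F v - d))"
    by (simp add: sum.distrib sum_subtractf flip: sum_distrib_right)
  finally show ?thesis unfolding r_sum unfolding r_def .
qed

lemma convex_chord_remainder_nonpos:
  fixes f :: "real \<Rightarrow> real" and d D i :: nat
  assumes f: "convex_on {0<..} f" and d: "d > 0" and i: "i \<le> D - d"
  shows "f (real (d + i)) - f (real d)
           - real i * ((f (real D) - f (real d)) / (real D - real d)) \<le> 0"
proof (cases "i = 0")
  case False
  have "convex_on {real d..real D} f"
    by (rule convex_on_subset[OF f]) (use d in auto)
  moreover have "real (d + i) \<in> {real d..real D}" using i False by auto
  ultimately have "f (real (d + i))
      \<le> (f (real D) - f (real d)) / (real D - real d) * (real (d + i) - real d) + f (real d)"
    by (rule convex_onD_Icc')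
  then show ?thesis by (simp add: algebra_simps)
qed simp

lemma concave_chord_remainder_nonneg:
  fixes f :: "real \<Rightarrow> real" and d D i :: nat
  assumes "concave_on {0<..} f" and "d > 0" and "i \<le> D - d"
  shows "f (real (d + i)) - f (real d)
           - real i * ((f (real D) - f (real d)) / (real D - real d)) \<ge> 0"
  using convex_chord_remainder_nonpos[of "\<lambda>x. - f x" d i D] assms
  by (simp add: concave_on_def algebra_simps diff_divide_distrib)

lemma powr_has_second_derivative:
  fixes a x :: real
  assumes "x > 0"
  shows "((\<lambda>x. x powr a) has_real_derivative a * x powr (a - 1)) (at x)"
    and "((\<lambda>x. a * x powr (a - 1)) has_real_derivative a * (a - 1) * x powr (a - 2)) (at x)"
  using assms by (auto intro!: derivative_eq_intros)

lemma convex_on_powr: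
  fixes a :: real
  assumes "a \<le> 0 \<or> a \<ge> 1"
  shows "convex_on {0<..} (\<lambda>x. x powr a)"
proof (rule f''_ge0_imp_convex)
  have "a * (a - 1) \<ge> 0"
    using assms by (auto simp: zero_le_mult_iff)
  then show "a * (a - 1) * x powr (a - 2) \<ge> 0" for x
    by simp
qed (use powr_has_second_derivative in auto)

lemma concave_on_powr:
  fixes a :: real
  assumes "0 \<le> a" and "a \<le> 1"
  shows "concave_on {0<..} (\<lambda>x. x powr a)"
proof (rule f''_le0_imp_concave)
  have "a * (a - 1) \<le> 0"
    using assms by (simp add: mult_nonneg_nonpos)
  then show "a * (a - 1) * x powr (a - 2) \<le> 0" for x
    by (simp add: mult_nonpos_nonneg)
qed (use powr_has_second_derivative in auto)


section \<open>The general Kulli-Basava index and its multiplicative version\<close>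

theorem theorem3p3:
  fixes G :: "('a, 'b) pre_digraph"
    and n m \<delta> \<Delta> M\<^sub>1 :: nat
    and N :: "nat \<Rightarrow> nat"
    and a s :: real
  assumes "graph G"
    and "Digraph_Component.connected G"
    and "n = card (verts G)"
    and "n \<ge> 3"
    and "m = card (uedges G)"
    and "\<And>i. N i = num_edge_nbhd_degree G i"
    and "\<delta> = min_edge_nbhd_degree G"
    and "\<Delta> = max_edge_nbhd_degree G"
    and "\<delta> \<noteq> \<Delta>"
    and "M\<^sub>1 = first_zagreb G"
    and "a \<noteq> 0"
    and "a \<noteq> 1"
    and "s = (real \<Delta> powr a - real \<delta> powr a) / (real \<Delta> - real \<delta>)"
  shows
    "(kulli_basava a G =
        real n * real \<delta> powr a + (2 * real M\<^sub>1 - 4 * real m - real n * real \<delta>) * s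
        + (\<Sum>i = 1..\<Delta> - \<delta> - 1. real (N (\<delta> + i)) *
             (real (\<delta> + i) powr a - real \<delta> powr a - real i * s))
      \<and> (a < 0 \<or> a > 1 \<longrightarrow>
          (\<forall>i\<in>{1..\<Delta> - \<delta> - 1}. real (\<delta> + i) powr a - real \<delta> powr a - real i * s \<le> 0))
      \<and> (0 < a \<and> a < 1 \<longrightarrow>
          (\<forall>i\<in>{1..\<Delta> - \<delta> - 1}. real (\<delta> + i) powr a - real \<delta> powr a - real i * s \<ge> 0)))
    \<and> ((a > 1 \<longrightarrow>
          ln (mult_kulli_basava a G) =
            a * (real n * ln (real \<delta>)
              + (2 * real M\<^sub>1 - 4 * real m - real n * real \<delta>) * (ln (real \<Delta>) - ln (real \<delta>))
                  / (real \<Delta> - real \<delta>)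
              + (\<Sum>i = 1..\<Delta> - \<delta> - 1. real (N (\<delta> + i)) *
                   (ln (real (\<delta> + i)) - ln (real \<delta>)
                    - real i * ((ln (real \<Delta>) - ln (real \<delta>)) / (real \<Delta> - real \<delta>))))))
      \<and> (\<forall>i\<in>{1..\<Delta> - \<delta> - 1}.
            ln (real (\<delta> + i)) - ln (real \<delta>)
            - real i * ((ln (real \<Delta>) - ln (real \<delta>)) / (real \<Delta> - real \<delta>)) \<ge> 0))"
proof -
  interpret graph G by fact
  let ?S = "edge_nbhd_degree G"
  let ?V = "verts G"
  have ne: "?V \<noteq> {}" using assms(3,4) by auto
  have range: "\<delta> \<le> ?S v \<and> ?S v \<le> \<Delta>" if "v \<in> ?V" for v
    using that by (simp add: assms(7,8) min_edge_nbhd_degree_def max_edge_nbhd_degree_def)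
  have "\<delta> \<in> ?S ` ?V"
    unfolding assms(7) min_edge_nbhd_degree_def by (rule Min_in) (use ne in auto)
  have pos: "?S v > 0" if "v \<in> ?V" for v
    using edge_nbhd_degree_pos assms(2,3,4) that by simp
  have d0: "\<delta> > 0" using \<open>\<delta> \<in> ?S ` ?V\<close> pos by auto
  have "\<delta> < \<Delta>" using \<open>\<delta> \<in> ?S ` ?V\<close> range \<open>\<delta> \<noteq> \<Delta>\<close> by fastforce
  have total: "(\<Sum>v\<in>?V. real (?S v)) = 2 * real M\<^sub>1 - 4 * real m"
    by (simp add: sum_edge_nbhd_degree assms(5,10))
  have N: "N i = card {v \<in> ?V. ?S v = i}" for i
    by (simp add: assms(6) num_edge_nbhd_degree_def)
  have expand: "(\<Sum>v\<in>?V. f (?S v)) =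
      real n * f \<delta> + (2 * real M\<^sub>1 - 4 * real m - real n * real \<delta>) * ((f \<Delta> - f \<delta>) / (real \<Delta> - real \<delta>))
      + (\<Sum>i = 1..\<Delta> - \<delta> - 1. real (N (\<delta> + i)) *
          (f (\<delta> + i) - f \<delta> - real i * ((f \<Delta> - f \<delta>) / (real \<Delta> - real \<delta>))))"
    for f :: "nat \<Rightarrow> real"
    unfolding total[symmetric] N assms(3)
    by (rule sum_eq_chord_plus_remainder) (use range \<open>\<delta> < \<Delta>\<close> in auto)
  have "kulli_basava a G =
        real n * real \<delta> powr a + (2 * real M\<^sub>1 - 4 * real m - real n * real \<delta>) * s
        + (\<Sum>i = 1..\<Delta> - \<delta> - 1. real (N (\<delta> + i)) *
             (real (\<delta> + i) powr a - real \<delta> powr a - real i * s))"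
    unfolding kulli_basava_def assms(13) by (rule expand[where f = "\<lambda>k. real k powr a"])
  moreover have "a < 0 \<or> a > 1 \<longrightarrow>
      (\<forall>i\<in>{1..\<Delta> - \<delta> - 1}. real (\<delta> + i) powr a - real \<delta> powr a - real i * s \<le> 0)"
    unfolding assms(13)
    using convex_chord_remainder_nonpos[OF convex_on_powr d0, where D = \<Delta>] by auto
  moreover have "0 < a \<and> a < 1 \<longrightarrow>
      (\<forall>i\<in>{1..\<Delta> - \<delta> - 1}. real (\<delta> + i) powr a - real \<delta> powr a - real i * s \<ge> 0)"
    unfolding assms(13)
    using concave_chord_remainder_nonneg[OF concave_on_powr d0, where D = \<Delta>] by auto
  moreover have "ln (mult_kulli_basava a G) =
            a * (real n * ln (real \<delta>)
              + (2 * real M\<^sub>1 - 4 * real m - real n * real \<delta>) * (ln (real \<Delta>) - ln (real \<delta>))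
                  / (real \<Delta> - real \<delta>)
              + (\<Sum>i = 1..\<Delta> - \<delta> - 1. real (N (\<delta> + i)) *
                   (ln (real (\<delta> + i)) - ln (real \<delta>)
                    - real i * ((ln (real \<Delta>) - ln (real \<delta>)) / (real \<Delta> - real \<delta>)))))"
  proof -
    have "ln (mult_kulli_basava a G) = (\<Sum>v\<in>?V. ln (real (?S v) powr a))"
      unfolding mult_kulli_basava_def by (rule ln_prod) (use pos in fastforce)+
    also have "\<dots> = a * (\<Sum>v\<in>?V. ln (real (?S v)))"
      unfolding sum_distrib_left by (rule sum.cong[OF refl]) (use pos in \<open>simp add: ln_powr\<close>)
    finally show ?thesis
      by (simp only: expand[where f = "\<lambda>k. ln (real k)"] times_divide_eq_right)
  qed
  moreover have "\<forall>i\<in>{1..\<Delta> - \<delta> - 1}.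
            ln (real (\<delta> + i)) - ln (real \<delta>)
            - real i * ((ln (real \<Delta>) - ln (real \<delta>)) / (real \<Delta> - real \<delta>)) \<ge> 0"
    using concave_chord_remainder_nonneg[OF ln_concave d0, where D = \<Delta>] by auto
  ultimately show ?thesis by blast
qed

end
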